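(* The variety $\mathsf{K}$ generated by all kites is generated by all finite-dimensional kites.
   Context: Kites. Let $\mathbf{G}$ be an $\ell$-group (written multiplicatively, identity $e$), $G^+=\{g: g\ge e\}$, $G^-=\{g: g\le e\}$. Let $I,J$ be sets with $|J|\le|I|$ and $\lambda,\rho\colon J\to I$ injections. The kite $K_{I,J}^{\lambda,\rho}(\mathbf{G})$ is the algebra $\langle (G^+)^J\uplus(G^-)^I;\vee,\wedge,\cdot,\backslash,/,1,0\rangle$ (disjoint union) whose order is coordinatewise inside $(G^+)^J$ and inside $(G^-)^I$, with every element of $(G^+)^J$ below every element of $(G^-)^I$. Elements of $(G^-)^I$ are written $\langle a_i^{-1}\rangle_{i\in I}$ with $a_i\in G^+$, elements of $(G^+)^J$ as $\langle f_j\rangle_{j\in J}$; $e^{-1}$ denotes $e$ as an element of $G^-$. $1$ is the constant sequence $e^{-1}$ in $(G^-)^I$ and $0$ the constant sequence $e$ in $(G^+)^J$. Multiplication: $\langle a_i^{-1}\rangle\cdot\langle b_i^{-1}\rangle=\langle (b_ia_i)^{-1}\rangle$; $\langle a_i^{-1}\rangle\cdot\langle f_j\rangle=\langle a_{\lambda(j)}^{-1}f_j\vee e\rangle_{j\in J}$; $\langle f_j\rangle\cdot\langle a_i^{-1}\rangle=\langle f_ja_{\rho(j)}^{-1}\vee e\rangle_{j\in J}$; $\langle f_j\rangle\cdot\langle g_j\rangle=0$. Divisions: $\langle a_i^{-1}\rangle\backslash\langle b_i^{-1}\rangle=\langle a_ib_i^{-1}\wedge e^{-1}\rangle$; $\langle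 b_i^{-1}\rangle/\langle a_i^{-1}\rangle=\langle b_i^{-1}a_i\wedge e^{-1}\rangle$; $\langle a_i^{-1}\rangle\backslash\langle f_j\rangle=\langle a_{\lambda(j)}f_j\rangle_{j}$; $\langle f_j\rangle/\langle a_i^{-1}\rangle=\langle f_ja_{\rho(j)}\rangle_{j}$; $\langle f_j\rangle\backslash\langle g_j\rangle$ is the element of $(G^-)^I$ whose $i$-th coordinate is $f_{\rho^{-1}(i)}^{-1}g_{\rho^{-1}(i)}\wedge e^{-1}$ if $i\in\rho(J)$ and $e^{-1}$ otherwise; $\langle g_j\rangle/\langle f_j\rangle$ is the element of $(G^-)^I$ whose $i$-th coordinate is $g_{\lambda^{-1}(i)}f_{\lambda^{-1}(i)}^{-1}\wedge e^{-1}$ if $i\in\lambda(J)$ and $e^{-1}$ otherwise; $\langle a_i^{-1}\rangle/\langle f_j\rangle=1=\langle f_j\rangle\backslash\langle a_i^{-1}\rangle$. A kite $K_{I,J}^{\lambda,\rho}(\mathbf{G})$ is $n$-dimensional if $|I|=n\in\omega$, and finite-dimensional if it is $n$-dimensional for some $n\in\omega$. "All kites" ranges over all $\ell$-groups $\mathbf{G}$ and all admissible $I,J,\lambda,\rho$. The signature is $\{\vee,\wedge,\cdot,\backslash,/,1,0\}$. *)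

theory Defs
  imports "HOL-Algebra.Group" "HOL-Algebra.Lattice"
begin

section \<open>Algebras, identities and varieties\<close>

record 'a fl_alg = "'a partial_object" +
  fl_join :: "'a \<Rightarrow> 'a \<Rightarrow> 'a"
  fl_meet :: "'a \<Rightarrow> 'a \<Rightarrow> 'a"
  fl_mult :: "'a \<Rightarrow> 'a \<Rightarrow> 'a"
  fl_ldiv :: "'a \<Rightarrow> 'a \<Rightarrow> 'a"   \<comment> \<open>\<open>fl_ldiv A x y\<close> is \<open>x \ y\<close>\<close>
  fl_rdiv :: "'a \<Rightarrow> 'a \<Rightarrow> 'a"   \<comment> \<open>\<open>fl_rdiv A x y\<close> is \<open>x / y\<close>\<close>
  fl_one :: 'a
  fl_zero :: 'a

definition fl_algebra :: "'a fl_alg \<Rightarrow> bool" where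
  "fl_algebra A \<longleftrightarrow>
     fl_one A \<in> carrier A \<and> fl_zero A \<in> carrier A \<and>
     (\<forall>x\<in>carrier A. \<forall>y\<in>carrier A.
        fl_join A x y \<in> carrier A \<and> fl_meet A x y \<in> carrier A \<and> fl_mult A x y \<in> carrier A \<and>
        fl_ldiv A x y \<in> carrier A \<and> fl_rdiv A x y \<in> carrier A)"

datatype fl_term =
    Var nat
  | Join fl_term fl_term
  | Meet fl_term fl_term
  | Mult fl_term fl_term
  | LDiv fl_term fl_term
  | RDiv fl_term fl_term
  | One
  | Zero

primrec fl_eval :: "'a fl_alg \<Rightarrow> (nat \<Rightarrow> 'a) \<Rightarrow> fl_term \<Rightarrow> 'a" where
  "fl_eval A v (Var n) = v n"
| "fl_eval A v (Join s t) = fl_join A (fl_eval A v s) (fl_eval A v t)"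
| "fl_eval A v (Meet s t) = fl_meet A (fl_eval A v s) (fl_eval A v t)"
| "fl_eval A v (Mult s t) = fl_mult A (fl_eval A v s) (fl_eval A v t)"
| "fl_eval A v (LDiv s t) = fl_ldiv A (fl_eval A v s) (fl_eval A v t)"
| "fl_eval A v (RDiv s t) = fl_rdiv A (fl_eval A v s) (fl_eval A v t)"
| "fl_eval A v One = fl_one A"
| "fl_eval A v Zero = fl_zero A"

type_synonym fl_identity = "fl_term \<times> fl_term"

definition satisfies :: "'a fl_alg \<Rightarrow> fl_identity \<Rightarrow> bool" where
  "satisfies A e \<longleftrightarrow>
     (\<forall>v. (\<forall>n. v n \<in> carrier A) \<longrightarrow> fl_eval A v (fst e) = fl_eval A v (snd e))"

text \<open>
  The variety (equational class) defined by a set of identities. It is a class of algebras of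
  arbitrary size, so it is rendered as a polymorphic family with one set for each carrier type.
\<close>

definition variety_of :: "fl_identity set \<Rightarrow> 'a fl_alg set" where
  "variety_of E = {A. fl_algebra A \<and> (\<forall>e\<in>E. satisfies A e)}"

text \<open>
  The smallest variety containing \<open>\<K>\<close>, as the intersection of all varieties containing \<open>\<K>\<close>.
  The carrier type \<open>'a\<close> of its members is independent of the carrier type \<open>'k\<close> of the generators.
\<close>

definition variety_generated_by :: "'k fl_alg set \<Rightarrow> 'a fl_alg set" where
  "variety_generated_by \<K> = (\<Inter>E \<in> {E. \<K> \<subseteq> variety_of E}. variety_of E)"


section \<open>Lattice-ordered groups\<close>

locale l_group = G: group G + L: lattice L
  for G :: "'g monoid" (structure) and L :: "'g gorder" (structure) +
  assumes same_carrier: "carrier L = carrier G"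
    and mult_mono: "\<lbrakk>x \<in> carrier G; y \<in> carrier G; a \<in> carrier G; b \<in> carrier G; x \<sqsubseteq>\<^bsub>L\<^esub> y\<rbrakk>
      \<Longrightarrow> a \<otimes>\<^bsub>G\<^esub> x \<otimes>\<^bsub>G\<^esub> b \<sqsubseteq>\<^bsub>L\<^esub> a \<otimes>\<^bsub>G\<^esub> y \<otimes>\<^bsub>G\<^esub> b"

definition pos_cone :: "'g monoid \<Rightarrow> 'g gorder \<Rightarrow> 'g set" where
  "pos_cone G L = {g \<in> carrier G. \<one>\<^bsub>G\<^esub> \<sqsubseteq>\<^bsub>L\<^esub> g}"

definition neg_cone :: "'g monoid \<Rightarrow> 'g gorder \<Rightarrow> 'g set" where
  "neg_cone G L = {g \<in> carrier G. g \<sqsubseteq>\<^bsub>L\<^esub> \<one>\<^bsub>G\<^esub>}"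


section \<open>Kites\<close>

text \<open>
  The summand \<open>Inl\<close> carries \<open>(G\<^sup>+)\<^sup>J\<close> and \<open>Inr\<close> carries \<open>(G\<^sup>-)\<^sup>I\<close>.
  The variables \<open>x, y\<close> below stand for elements of \<open>(G\<^sup>-)\<^sup>I\<close> themselves: \<open>x i\<close> is what is
  traditionally written \<open>a\<^sub>i\<close> inverse with \<open>a\<^sub>i\<close> positive, so that \<open>a\<^sub>i\<close> becomes \<open>inv (x i)\<close>.
\<close>

fun kite_join :: "'g gorder \<Rightarrow> 'i set \<Rightarrow> 'j set \<Rightarrow>
    ('j \<Rightarrow> 'g) + ('i \<Rightarrow> 'g) \<Rightarrow> ('j \<Rightarrow> 'g) + ('i \<Rightarrow> 'g) \<Rightarrow> ('j \<Rightarrow> 'g) + ('i \<Rightarrow> 'g)" where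
  "kite_join L I J (Inl f) (Inl g) = Inl (\<lambda>j\<in>J. f j \<squnion>\<^bsub>L\<^esub> g j)"
| "kite_join L I J (Inl f) (Inr y) = Inr y"
| "kite_join L I J (Inr x) (Inl g) = Inr x"
| "kite_join L I J (Inr x) (Inr y) = Inr (\<lambda>i\<in>I. x i \<squnion>\<^bsub>L\<^esub> y i)"

fun kite_meet :: "'g gorder \<Rightarrow> 'i set \<Rightarrow> 'j set \<Rightarrow>
    ('j \<Rightarrow> 'g) + ('i \<Rightarrow> 'g) \<Rightarrow> ('j \<Rightarrow> 'g) + ('i \<Rightarrow> 'g) \<Rightarrow> ('j \<Rightarrow> 'g) + ('i \<Rightarrow> 'g)" where
  "kite_meet L I J (Inl f) (Inl g) = Inl (\<lambda>j\<in>J. f j \<sqinter>\<^bsub>L\<^esub> g j)"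
| "kite_meet L I J (Inl f) (Inr y) = Inl f"
| "kite_meet L I J (Inr x) (Inl g) = Inl g"
| "kite_meet L I J (Inr x) (Inr y) = Inr (\<lambda>i\<in>I. x i \<sqinter>\<^bsub>L\<^esub> y i)"

fun kite_mult :: "'g monoid \<Rightarrow> 'g gorder \<Rightarrow> 'i set \<Rightarrow> 'j set \<Rightarrow> ('j \<Rightarrow> 'i) \<Rightarrow> ('j \<Rightarrow> 'i) \<Rightarrow>
    ('j \<Rightarrow> 'g) + ('i \<Rightarrow> 'g) \<Rightarrow> ('j \<Rightarrow> 'g) + ('i \<Rightarrow> 'g) \<Rightarrow> ('j \<Rightarrow> 'g) + ('i \<Rightarrow> 'g)" where
  "kite_mult G L I J l r (Inr x) (Inr y) = Inr (\<lambda>i\<in>I. x i \<otimes>\<^bsub>G\<^esub> y i)"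
| "kite_mult G L I J l r (Inr x) (Inl f) = Inl (\<lambda>j\<in>J. (x (l j) \<otimes>\<^bsub>G\<^esub> f j) \<squnion>\<^bsub>L\<^esub> \<one>\<^bsub>G\<^esub>)"
| "kite_mult G L I J l r (Inl f) (Inr x) = Inl (\<lambda>j\<in>J. (f j \<otimes>\<^bsub>G\<^esub> x (r j)) \<squnion>\<^bsub>L\<^esub> \<one>\<^bsub>G\<^esub>)"
| "kite_mult G L I J l r (Inl f) (Inl g) = Inl (\<lambda>j\<in>J. \<one>\<^bsub>G\<^esub>)"

fun kite_ldiv :: "'g monoid \<Rightarrow> 'g gorder \<Rightarrow> 'i set \<Rightarrow> 'j set \<Rightarrow> ('j \<Rightarrow> 'i) \<Rightarrow> ('j \<Rightarrow> 'i) \<Rightarrow>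
    ('j \<Rightarrow> 'g) + ('i \<Rightarrow> 'g) \<Rightarrow> ('j \<Rightarrow> 'g) + ('i \<Rightarrow> 'g) \<Rightarrow> ('j \<Rightarrow> 'g) + ('i \<Rightarrow> 'g)" where
  "kite_ldiv G L I J l r (Inr x) (Inr y) = Inr (\<lambda>i\<in>I. (inv\<^bsub>G\<^esub> (x i) \<otimes>\<^bsub>G\<^esub> y i) \<sqinter>\<^bsub>L\<^esub> \<one>\<^bsub>G\<^esub>)"
| "kite_ldiv G L I J l r (Inr x) (Inl f) = Inl (\<lambda>j\<in>J. inv\<^bsub>G\<^esub> (x (l j)) \<otimes>\<^bsub>G\<^esub> f j)"
| "kite_ldiv G L I J l r (Inl f) (Inl g) = Inr (\<lambda>i\<in>I. if i \<in> r ` J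
     then (inv\<^bsub>G\<^esub> (f (the_inv_into J r i)) \<otimes>\<^bsub>G\<^esub> g (the_inv_into J r i)) \<sqinter>\<^bsub>L\<^esub> \<one>\<^bsub>G\<^esub>
     else \<one>\<^bsub>G\<^esub>)"
| "kite_ldiv G L I J l r (Inl f) (Inr x) = Inr (\<lambda>i\<in>I. \<one>\<^bsub>G\<^esub>)"

fun kite_rdiv :: "'g monoid \<Rightarrow> 'g gorder \<Rightarrow> 'i set \<Rightarrow> 'j set \<Rightarrow> ('j \<Rightarrow> 'i) \<Rightarrow> ('j \<Rightarrow> 'i) \<Rightarrow>
    ('j \<Rightarrow> 'g) + ('i \<Rightarrow> 'g) \<Rightarrow> ('j \<Rightarrow> 'g) + ('i \<Rightarrow> 'g) \<Rightarrow> ('j \<Rightarrow> 'g) + ('i \<Rightarrow> 'g)" where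
  "kite_rdiv G L I J l r (Inr y) (Inr x) = Inr (\<lambda>i\<in>I. (y i \<otimes>\<^bsub>G\<^esub> inv\<^bsub>G\<^esub> (x i)) \<sqinter>\<^bsub>L\<^esub> \<one>\<^bsub>G\<^esub>)"
| "kite_rdiv G L I J l r (Inl f) (Inr x) = Inl (\<lambda>j\<in>J. f j \<otimes>\<^bsub>G\<^esub> inv\<^bsub>G\<^esub> (x (r j)))"
| "kite_rdiv G L I J l r (Inl g) (Inl f) = Inr (\<lambda>i\<in>I. if i \<in> l ` J
     then (g (the_inv_into J l i) \<otimes>\<^bsub>G\<^esub> inv\<^bsub>G\<^esub> (f (the_inv_into J l i))) \<sqinter>\<^bsub>L\<^esub> \<one>\<^bsub>G\<^esub>
     else \<one>\<^bsub>G\<^esub>)"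
| "kite_rdiv G L I J l r (Inr x) (Inl f) = Inr (\<lambda>i\<in>I. \<one>\<^bsub>G\<^esub>)"

definition kite :: "'g monoid \<Rightarrow> 'g gorder \<Rightarrow> 'i set \<Rightarrow> 'j set \<Rightarrow> ('j \<Rightarrow> 'i) \<Rightarrow> ('j \<Rightarrow> 'i) \<Rightarrow>
    (('j \<Rightarrow> 'g) + ('i \<Rightarrow> 'g)) fl_alg" where
  "kite G L I J l r =
     \<lparr>carrier = (J \<rightarrow>\<^sub>E pos_cone G L) <+> (I \<rightarrow>\<^sub>E neg_cone G L),
      fl_join = kite_join L I J,
      fl_meet = kite_meet L I J,
      fl_mult = kite_mult G L I J l r,
      fl_ldiv = kite_ldiv G L I J l r,
      fl_rdiv = kite_rdiv G L I J l r,
      fl_one = Inr (\<lambda>i\<in>I. \<one>\<^bsub>G\<^esub>),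
      fl_zero = Inl (\<lambda>j\<in>J. \<one>\<^bsub>G\<^esub>)\<rparr>"

text \<open>The condition \<open>|J| \<le> |I|\<close> on the index sets is witnessed by the injection \<open>l\<close>.\<close>

definition kite_data :: "'g monoid \<Rightarrow> 'g gorder \<Rightarrow> 'i set \<Rightarrow> 'j set \<Rightarrow> ('j \<Rightarrow> 'i) \<Rightarrow> ('j \<Rightarrow> 'i) \<Rightarrow> bool"
  where
  "kite_data G L I J l r \<longleftrightarrow>
     l_group G L \<and> l ` J \<subseteq> I \<and> inj_on l J \<and> r ` J \<subseteq> I \<and> inj_on r J"

definition kites :: "(('j \<Rightarrow> 'g) + ('i \<Rightarrow> 'g)) fl_alg set" where
  "kites = {kite G L I J l r |G L I J l r. kite_data G L I J l r}"

definition n_dimensional_kites :: "nat \<Rightarrow> (('j \<Rightarrow> 'g) + ('i \<Rightarrow> 'g)) fl_alg set" where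
  "n_dimensional_kites n =
     {kite G L I J l r |G L I J l r. kite_data G L I J l r \<and> finite I \<and> card I = n}"

definition finite_dimensional_kites :: "(('j \<Rightarrow> 'g) + ('i \<Rightarrow> 'g)) fl_alg set" where
  "finite_dimensional_kites = (\<Union>n. n_dimensional_kites n)"

text \<open>
  Kites are algebras of the signature. In particular \<open>kites \<subseteq> variety_of {}\<close>, so the intersection
  in \<open>variety_generated_by kites\<close> is not the empty one.
\<close>

lemma kite_fl_algebra:
  assumes "kite_data G L I J l r"
  shows "fl_algebra (kite G L I J l r)"
proof -
  interpret l_group G L using assms by (simp add: kite_data_def)
  have l: "\<And>j. j \<in> J \<Longrightarrow> l j \<in> I" "inj_on l J" and r: "\<And>j. j \<in> J \<Longrightarrow> r j \<in> I" "inj_on r J"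
    using assms by (auto simp: kite_data_def)
  note c [simp] = same_carrier
  have join: "x \<squnion>\<^bsub>L\<^esub> y \<in> carrier G" "x \<sqsubseteq>\<^bsub>L\<^esub> x \<squnion>\<^bsub>L\<^esub> y" "y \<sqsubseteq>\<^bsub>L\<^esub> x \<squnion>\<^bsub>L\<^esub> y"
    and meet: "x \<sqinter>\<^bsub>L\<^esub> y \<in> carrier G" "x \<sqinter>\<^bsub>L\<^esub> y \<sqsubseteq>\<^bsub>L\<^esub> x" "x \<sqinter>\<^bsub>L\<^esub> y \<sqsubseteq>\<^bsub>L\<^esub> y"
    if "x \<in> carrier G" "y \<in> carrier G" for x y
    using that L.join_closed [of x y] L.meet_closed [of x y] L.join_left L.join_right
      L.meet_left L.meet_right by auto
  have pos_join: "x \<squnion>\<^bsub>L\<^esub> y \<in> pos_cone G L"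
    if "x \<in> carrier G" "y \<in> pos_cone G L" for x y
    using that join [of x y] L.le_trans [of "\<one>\<^bsub>G\<^esub>" y "x \<squnion>\<^bsub>L\<^esub> y"] by (auto simp: pos_cone_def)
  have pos_meet: "x \<sqinter>\<^bsub>L\<^esub> y \<in> pos_cone G L"
    if "x \<in> pos_cone G L" "y \<in> pos_cone G L" for x y
    using that meet [of x y] L.meet_le [of "\<one>\<^bsub>G\<^esub>" x y] by (auto simp: pos_cone_def)
  have neg_meet: "x \<sqinter>\<^bsub>L\<^esub> y \<in> neg_cone G L"
    if "x \<in> carrier G" "y \<in> neg_cone G L" for x y
    using that meet [of x y] L.le_trans [of "x \<sqinter>\<^bsub>L\<^esub> y" y "\<one>\<^bsub>G\<^esub>"] by (auto simp: neg_cone_def)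
  have neg_join: "x \<squnion>\<^bsub>L\<^esub> y \<in> neg_cone G L"
    if "x \<in> neg_cone G L" "y \<in> neg_cone G L" for x y
    using that join [of x y] L.join_le [of x "\<one>\<^bsub>G\<^esub>" y] by (auto simp: neg_cone_def)
  have one: "\<one>\<^bsub>G\<^esub> \<in> pos_cone G L" "\<one>\<^bsub>G\<^esub> \<in> neg_cone G L"
    by (auto simp: pos_cone_def neg_cone_def)
  have cones: "x \<in> pos_cone G L \<Longrightarrow> x \<in> carrier G" "x \<in> neg_cone G L \<Longrightarrow> x \<in> carrier G" for x
    by (auto simp: pos_cone_def neg_cone_def)
  have pos_mult: "x \<otimes>\<^bsub>G\<^esub> y \<in> pos_cone G L" if "x \<in> pos_cone G L" "y \<in> pos_cone G L" for x y
    using that mult_mono [of "\<one>\<^bsub>G\<^esub>" y x "\<one>\<^bsub>G\<^esub>"] L.le_trans [of "\<one>\<^bsub>G\<^esub>" x "x \<otimes>\<^bsub>G\<^esub> y"]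
    by (auto simp: pos_cone_def)
  have neg_mult: "x \<otimes>\<^bsub>G\<^esub> y \<in> neg_cone G L" if "x \<in> neg_cone G L" "y \<in> neg_cone G L" for x y
    using that mult_mono [of y "\<one>\<^bsub>G\<^esub>" x "\<one>\<^bsub>G\<^esub>"] L.le_trans [of "x \<otimes>\<^bsub>G\<^esub> y" x "\<one>\<^bsub>G\<^esub>"]
    by (auto simp: neg_cone_def)
  have inv: "inv\<^bsub>G\<^esub> x \<in> pos_cone G L" if "x \<in> neg_cone G L" for x
    using that mult_mono [of x "\<one>\<^bsub>G\<^esub>" "inv\<^bsub>G\<^esub> x" "\<one>\<^bsub>G\<^esub>"] by (auto simp: pos_cone_def neg_cone_def)
  have app: "f j \<in> pos_cone G L" if "f \<in> J \<rightarrow>\<^sub>E pos_cone G L" "j \<in> J" for f j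
    using that by auto
  have app': "x i \<in> neg_cone G L" if "x \<in> I \<rightarrow>\<^sub>E neg_cone G L" "i \<in> I" for x i
    using that by auto
  have the_r: "the_inv_into J r i \<in> J" if "i \<in> r ` J" for i
    using that r by (auto simp: the_inv_into_f_f)
  have the_l: "the_inv_into J l i \<in> J" if "i \<in> l ` J" for i
    using that l by (auto simp: the_inv_into_f_f)
  note facts = one pos_join pos_meet neg_join neg_meet pos_mult neg_mult inv cones app app'
    the_r the_l l(1) r(1)
  have "fl_join (kite G L I J l r) u v \<in> carrier (kite G L I J l r) \<and>
        fl_meet (kite G L I J l r) u v \<in> carrier (kite G L I J l r) \<and>
        fl_mult (kite G L I J l r) u v \<in> carrier (kite G L I J l r) \<and>
        fl_ldiv (kite G L I J l r) u v \<in> carrier (kite G L I J l r) \<and>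
        fl_rdiv (kite G L I J l r) u v \<in> carrier (kite G L I J l r)"
    if "u \<in> carrier (kite G L I J l r)" "v \<in> carrier (kite G L I J l r)" for u v
  proof (cases u; cases v)
    fix f g assume [simp]: "u = Inl f" "v = Inl g"
    with that have "f \<in> J \<rightarrow>\<^sub>E pos_cone G L" "g \<in> J \<rightarrow>\<^sub>E pos_cone G L" by (auto simp: kite_def)
    then show ?thesis
      by (simp add: kite_def Plus_def image_iff facts restrict_PiE_iff)
  next
    fix f y assume [simp]: "u = Inl f" "v = Inr y"
    with that have "f \<in> J \<rightarrow>\<^sub>E pos_cone G L" "y \<in> I \<rightarrow>\<^sub>E neg_cone G L" by (auto simp: kite_def)
    then show ?thesis
      by (simp add: kite_def Plus_def image_iff facts restrict_PiE_iff)
  next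
    fix x g assume [simp]: "u = Inr x" "v = Inl g"
    with that have "x \<in> I \<rightarrow>\<^sub>E neg_cone G L" "g \<in> J \<rightarrow>\<^sub>E pos_cone G L" by (auto simp: kite_def)
    then show ?thesis
      by (simp add: kite_def Plus_def image_iff facts restrict_PiE_iff)
  next
    fix x y assume [simp]: "u = Inr x" "v = Inr y"
    with that have "x \<in> I \<rightarrow>\<^sub>E neg_cone G L" "y \<in> I \<rightarrow>\<^sub>E neg_cone G L" by (auto simp: kite_def)
    then show ?thesis
      by (simp add: kite_def Plus_def image_iff facts restrict_PiE_iff)
  qed
  moreover have "fl_one (kite G L I J l r) \<in> carrier (kite G L I J l r)"
    "fl_zero (kite G L I J l r) \<in> carrier (kite G L I J l r)"
    using one by (auto simp: kite_def)
  ultimately show ?thesis by (simp add: fl_algebra_def)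
qed

end

theory Submission
  imports Defs
begin

text \<open>
  View \<open>I\<close> as the vertices and \<open>J\<close> as the edges of a graph, the edge \<open>j\<close> joining \<open>l j\<close> to \<open>r j\<close>.
  A coordinate of the result of a kite operation depends only on the coordinates of the arguments
  at the incident vertices and edges, of which there are finitely many because \<open>l\<close> and \<open>r\<close> are
  injective. Hence one coordinate of the value of a term depends on a finite part of the graph
  only. If two terms differ at some coordinate, then they still differ in the kite over a finite
  subgraph containing everything on which this coordinate depends, although restriction to the
  subgraph is not a homomorphism: divisions are distorted at its boundary. In which summand the
  value lies depends on the summands of the variables only.
\<close>

lemma fl_eval_closed:
  assumes "fl_algebra A" and "\<And>n. v n \<in> carrier A"
  shows "fl_eval A v t \<in> carrier A"
  using assms by (induction t) (auto simp: fl_algebra_def)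

fun kite_restrict :: "'i set \<Rightarrow> 'j set \<Rightarrow> ('j \<Rightarrow> 'g) + ('i \<Rightarrow> 'g) \<Rightarrow> ('j \<Rightarrow> 'g) + ('i \<Rightarrow> 'g)" where
  "kite_restrict A B (Inl f) = Inl (restrict f B)"
| "kite_restrict A B (Inr x) = Inr (restrict x A)"

text \<open>Kites over different index sets share one carrier type, so their elements can be
  compared directly. Elements of different summands never agree, even for empty
  \<open>S\<close>.\<close>

fun agree_on :: "('j + 'i) set \<Rightarrow> ('j \<Rightarrow> 'g) + ('i \<Rightarrow> 'g) \<Rightarrow> ('j \<Rightarrow> 'g) + ('i \<Rightarrow> 'g) \<Rightarrow> bool" where
  "agree_on S (Inl f) (Inl g) \<longleftrightarrow> (\<forall>j. Inl j \<in> S \<longrightarrow> f j = g j)"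
| "agree_on S (Inr x) (Inr y) \<longleftrightarrow> (\<forall>i. Inr i \<in> S \<longrightarrow> x i = y i)"
| "agree_on S _ _ \<longleftrightarrow> False"

text \<open>The closed neighbourhood of \<open>S\<close> in the incidence graph, whose nodes are
  vertices and edges alike.\<close>

definition nbhd :: "'j set \<Rightarrow> ('j \<Rightarrow> 'i) \<Rightarrow> ('j \<Rightarrow> 'i) \<Rightarrow> ('j + 'i) set \<Rightarrow> ('j + 'i) set" where
  "nbhd J l r S = S \<union> Inr ` l ` (Inl -` S) \<union> Inr ` r ` (Inl -` S)
     \<union> Inl ` (l -` (Inr -` S) \<inter> J) \<union> Inl ` (r -` (Inr -` S) \<inter> J)"

lemma finite_nbhd:
  assumes "finite S" "inj_on l J" "inj_on r J"
  shows "finite (nbhd J l r S)"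
  using assms unfolding nbhd_def
  by (auto intro!: finite_imageI finite_vimageI finite_vimage_IntI)

lemma nbhd_subset:
  assumes "S \<subseteq> J <+> I" "l ` J \<subseteq> I" "r ` J \<subseteq> I"
  shows "nbhd J l r S \<subseteq> J <+> I"
  using assms unfolding nbhd_def by auto

lemma agree_on_kite_restrict:
  assumes "S \<subseteq> B <+> A"
  shows "agree_on S u (kite_restrict A B u)"
  using assms by (cases u) auto

lemma the_inv_into_subset:
  assumes "inj_on h J" "B \<subseteq> J" "j \<in> B"
  shows "the_inv_into J h (h j) = j" "the_inv_into B h (h j) = j"
  using assms inj_on_subset [of h J B] by (auto intro: the_inv_into_f_f)

text \<open>The delicate case is the division of two \<open>Inl\<close> elements: its value at a
  vertex depends on whether an edge ends there. The neighbourhood is taken in the large graph, so no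
  edge at a vertex of \<open>S\<close> is cut off in the part given by \<open>A\<close> and
  \<open>B\<close>.\<close>

lemma agree_on_op:
  assumes inj: "inj_on l J" "inj_on r J"
    and S: "S \<subseteq> J <+> I" and N: "nbhd J l r S \<subseteq> B <+> A"
    and sub: "B \<subseteq> J" "A \<subseteq> I"
    and u: "agree_on (nbhd J l r S) u u'" and v: "agree_on (nbhd J l r S) v v'"
  shows "agree_on S (kite_join L I J u v) (kite_join L A B u' v')"
    and "agree_on S (kite_meet L I J u v) (kite_meet L A B u' v')"
    and "agree_on S (kite_mult G L I J l r u v) (kite_mult G L A B l r u' v')"
    and "agree_on S (kite_ldiv G L I J l r u v) (kite_ldiv G L A B l r u' v')"
    and "agree_on S (kite_rdiv G L I J l r u v) (kite_rdiv G L A B l r u' v')"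
proof -
  have j: "j \<in> J" "j \<in> B" "Inl j \<in> nbhd J l r S" "Inr (l j) \<in> nbhd J l r S"
    "Inr (r j) \<in> nbhd J l r S" if "Inl j \<in> S" for j
    using that S N by (auto simp: nbhd_def)
  have i: "i \<in> I" "i \<in> A" "Inr i \<in> nbhd J l r S" if "Inr i \<in> S" for i
    using that S N by (auto simp: nbhd_def)
  have edge: "Inl j \<in> nbhd J l r S" "j \<in> B" if "j \<in> J" "Inr (l j) \<in> S \<or> Inr (r j) \<in> S" for j
  proof -
    show "Inl j \<in> nbhd J l r S"
      using that by (auto simp: nbhd_def)
    with N show "j \<in> B" by blast
  qed
  \<comment> \<open>The facts \<open>l\<close> and \<open>r\<close> make the case distinctions of
    the divisions coincide. The facts \<open>l'\<close> and \<open>r'\<close> identify the edges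
    looked up, since \<open>the_inv_into\<close> is relative to \<open>B\<close> in one kite and to
    \<open>J\<close> in the other.\<close>
  have l: "i \<in> l ` B \<longleftrightarrow> i \<in> l ` J" if "Inr i \<in> S" for i
    using that edge sub by auto
  have r: "i \<in> r ` B \<longleftrightarrow> i \<in> r ` J" if "Inr i \<in> S" for i
    using that edge sub by auto
  have l': "the_inv_into B l i = the_inv_into J l i" "Inl (the_inv_into J l i) \<in> nbhd J l r S"
    if "Inr i \<in> S" "i \<in> l ` J" for i
    using that edge the_inv_into_subset [OF inj(1) sub(1)] by auto
  have r': "the_inv_into B r i = the_inv_into J r i" "Inl (the_inv_into J r i) \<in> nbhd J l r S"
    if "Inr i \<in> S" "i \<in> r ` J" for i
    using that edge the_inv_into_subset [OF inj(2) sub(1)] by auto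
  note facts = j i l r l' r'
  show "agree_on S (kite_join L I J u v) (kite_join L A B u' v')"
    using u v by (cases u; cases u'; cases v; cases v') (simp_all add: facts)
  show "agree_on S (kite_meet L I J u v) (kite_meet L A B u' v')"
    using u v by (cases u; cases u'; cases v; cases v') (simp_all add: facts)
  show "agree_on S (kite_mult G L I J l r u v) (kite_mult G L A B l r u' v')"
    using u v by (cases u; cases u'; cases v; cases v') (simp_all add: facts)
  show "agree_on S (kite_ldiv G L I J l r u v) (kite_ldiv G L A B l r u' v')"
    using u v by (cases u; cases u'; cases v; cases v') (simp_all add: facts)
  show "agree_on S (kite_rdiv G L I J l r u v) (kite_rdiv G L A B l r u' v')"
    using u v by (cases u; cases u'; cases v; cases v') (simp_all add: facts)
qed

text \<open>Quantifying over all parts that contain \<open>T\<close> makes the notion stable under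
  enlarging \<open>T\<close>: supports of subterms can be united, and endpoints of edges can be
  added afterwards.\<close>

definition supports :: "'g monoid \<Rightarrow> 'g gorder \<Rightarrow> 'i set \<Rightarrow> 'j set \<Rightarrow> ('j \<Rightarrow> 'i) \<Rightarrow> ('j \<Rightarrow> 'i) \<Rightarrow>
    (nat \<Rightarrow> ('j \<Rightarrow> 'g) + ('i \<Rightarrow> 'g)) \<Rightarrow> ('j + 'i) set \<Rightarrow> ('j + 'i) set \<Rightarrow> fl_term \<Rightarrow> bool" where
  "supports G L I J l r v T S t \<longleftrightarrow>
     (\<forall>A B. A \<subseteq> I \<longrightarrow> B \<subseteq> J \<longrightarrow> T \<subseteq> B <+> A \<longrightarrow>
        agree_on S (fl_eval (kite G L I J l r) v t)
          (fl_eval (kite G L A B l r) (kite_restrict A B \<circ> v) t))"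

text \<open>Induction on the term with \<open>S\<close> arbitrary: a compound term on
  \<open>S\<close> needs its immediate subterms on the neighbourhood of \<open>S\<close>, so the set
  to be controlled grows by one finite step per level of nesting.\<close>

lemma finite_support:
  assumes "l ` J \<subseteq> I" "inj_on l J" "r ` J \<subseteq> I" "inj_on r J" "finite S" "S \<subseteq> J <+> I"
  shows "\<exists>T. finite T \<and> T \<subseteq> J <+> I \<and> supports G L I J l r v T S t"
proof -
  \<comment> \<open>The five binary cases at once, with \<open>c\<close> the term
    constructor.\<close>
  have op: "\<exists>T. finite T \<and> T \<subseteq> J <+> I \<and> supports G L I J l r v T S (c s t)"
    if c: "c \<in> {Join, Meet, Mult, LDiv, RDiv}"
      and IH: "\<And>S. \<lbrakk>finite S; S \<subseteq> J <+> I\<rbrakk> \<Longrightarrow>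
        \<exists>T. finite T \<and> T \<subseteq> J <+> I \<and> supports G L I J l r v T S s"
      "\<And>S. \<lbrakk>finite S; S \<subseteq> J <+> I\<rbrakk> \<Longrightarrow>
        \<exists>T. finite T \<and> T \<subseteq> J <+> I \<and> supports G L I J l r v T S t"
      and S: "finite S" "S \<subseteq> J <+> I" for S s t c
  proof -
    let ?N = "nbhd J l r S"
    have N: "finite ?N" "?N \<subseteq> J <+> I"
      by (rule finite_nbhd [OF S(1) assms(2,4)], rule nbhd_subset [OF S(2) assms(1,3)])
    obtain T T' where T: "finite T" "T \<subseteq> J <+> I" "supports G L I J l r v T ?N s"
      and T': "finite T'" "T' \<subseteq> J <+> I" "supports G L I J l r v T' ?N t"
      using IH [OF N] by blast
    \<comment> \<open>Besides the supports of both subterms, the part must contain \<open>?N\<close>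
      itself, as \<open>agree_on_op\<close> demands for the outermost operation.\<close>
    have "agree_on S (fl_eval (kite G L I J l r) v (c s t))
        (fl_eval (kite G L A B l r) (kite_restrict A B \<circ> v) (c s t))"
      if AB: "A \<subseteq> I" "B \<subseteq> J" "?N \<union> T \<union> T' \<subseteq> B <+> A" for A B
    proof -
      have "agree_on ?N (fl_eval (kite G L I J l r) v s)
          (fl_eval (kite G L A B l r) (kite_restrict A B \<circ> v) s)"
        "agree_on ?N (fl_eval (kite G L I J l r) v t)
          (fl_eval (kite G L A B l r) (kite_restrict A B \<circ> v) t)"
        using T(3) T'(3) AB by (simp_all add: supports_def)
      moreover have "?N \<subseteq> B <+> A"
        using AB(3) by blast
      ultimately show ?thesis
        using c agree_on_op [OF assms(2,4) S(2) _ AB(2,1)] by (auto simp: kite_def)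
    qed
    with N T T' show ?thesis
      by (intro exI [of _ "?N \<union> T \<union> T'"]) (simp add: supports_def)
  qed
  show ?thesis
    using assms(5,6)
  proof (induction t arbitrary: S)
    \<comment> \<open>At the leaves \<open>T = S\<close> is chosen: values in the small kite are
      \<open>undefined\<close> off \<open>A\<close> and \<open>B\<close>, so \<open>S\<close> has to
      lie inside.\<close>
    case (Var n)
    then show ?case
      by (intro exI [of _ S]) (auto simp: supports_def intro: agree_on_kite_restrict)
  next
    case One
    then show ?case
      by (intro exI [of _ S]) (auto simp: supports_def kite_def)
  next
    case Zero
    then show ?case
      by (intro exI [of _ S]) (auto simp: supports_def kite_def)
  next
    case (Join s t)
    then show ?case
      by (intro op [of Join]) simp_all
  next
    case (Meet s t)
    then show ?case
      by (intro op [of Meet]) simp_all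
  next
    case (Mult s t)
    then show ?case
      by (intro op [of Mult]) simp_all
  next
    case (LDiv s t)
    then show ?case
      by (intro op [of LDiv]) simp_all
  next
    case (RDiv s t)
    then show ?case
      by (intro op [of RDiv]) simp_all
  qed
qed

text \<open>The finite part may depend on the coordinate at which the two sides are compared; there
  both agree with their common value in the finite kite.\<close>

lemma satisfies_if_finite_subkites:
  assumes K: "kite_data G L I J l r"
    and fin: "\<And>A B. \<lbrakk>finite A; kite_data G L A B l r\<rbrakk> \<Longrightarrow> satisfies (kite G L A B l r) (s, t)"
  shows "satisfies (kite G L I J l r) (s, t)"
  unfolding satisfies_def fst_conv snd_conv
proof (intro allI impI)
  fix v :: "nat \<Rightarrow> _" assume v: "\<forall>n. v n \<in> carrier (kite G L I J l r)"
  let ?e = "fl_eval (kite G L I J l r) v"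
  have lr: "l ` J \<subseteq> I" "inj_on l J" "r ` J \<subseteq> I" "inj_on r J" and G: "l_group G L"
    using K by (auto simp: kite_data_def)
  have agree: "\<exists>w. agree_on S (?e s) w \<and> agree_on S (?e t) w"
    if S: "finite S" "S \<subseteq> J <+> I" for S
  proof -
    obtain T T' where T: "finite T" "T \<subseteq> J <+> I" "supports G L I J l r v T S s"
      and T': "finite T'" "T' \<subseteq> J <+> I" "supports G L I J l r v T' S t"
      using finite_support [OF lr S] by metis
    \<comment> \<open>The edges of both supports, and then their vertices together with all
      endpoints of \<open>B\<close>, so that \<open>l\<close> and \<open>r\<close> map
      \<open>B\<close> into \<open>A\<close> and the part carries a kite.\<close>
    define B where "B = Inl -` (T \<union> T')"
    define A where "A = Inr -` (T \<union> T') \<union> l ` B \<union> r ` B"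
    have B: "finite B" "B \<subseteq> J"
      using T T' by (auto simp: B_def intro: finite_vimageI)
    have "l ` B \<subseteq> I" "r ` B \<subseteq> I"
      using lr B(2) by blast+
    with T T' B(1) have A: "finite A" "A \<subseteq> I"
      by (auto simp: A_def intro: finite_vimageI)
    have TAB: "T \<subseteq> B <+> A" "T' \<subseteq> B <+> A"
      using T(2) T'(2) by (force simp: A_def B_def)+
    have AB: "kite_data G L A B l r"
      using G lr inj_on_subset [OF _ B(2)] by (auto simp: kite_data_def A_def)
    have "kite_restrict A B (v n) \<in> carrier (kite G L A B l r)" for n
      using v [rule_format, of n] A(2) B(2) by (cases "v n") (auto simp: kite_def)
    with fin [OF A(1) AB]
    have "fl_eval (kite G L A B l r) (kite_restrict A B \<circ> v) s
        = fl_eval (kite G L A B l r) (kite_restrict A B \<circ> v) t"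
      by (simp add: satisfies_def)
    moreover have "agree_on S (?e s) (fl_eval (kite G L A B l r) (kite_restrict A B \<circ> v) s)"
      "agree_on S (?e t) (fl_eval (kite G L A B l r) (kite_restrict A B \<circ> v) t)"
      using T(3) T'(3) TAB A(2) B(2) by (simp_all add: supports_def)
    ultimately show ?thesis by (intro exI conjI) simp_all
  qed
  have same: "agree_on S (?e s) (?e t)" if S: "finite S" "S \<subseteq> J <+> I" for S
  proof -
    obtain w where "agree_on S (?e s) w" "agree_on S (?e t) w"
      using agree [OF S] by blast
    then show ?thesis
      by (cases "?e s"; cases "?e t"; cases w) simp_all
  qed
  \<comment> \<open>Members of the carrier are extensional, so agreement at all indices gives
    equality.\<close>
  have closed: "?e s \<in> carrier (kite G L I J l r)" "?e t \<in> carrier (kite G L I J l r)"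
    using fl_eval_closed [OF kite_fl_algebra [OF K]] v by auto
  show "?e s = ?e t"
  proof (cases "?e s"; cases "?e t")
    fix f g assume e: "?e s = Inl f" "?e t = Inl g"
    have "f j = g j" if "j \<in> J" for j
      using same [of "{Inl j}"] that e by auto
    moreover have "f \<in> J \<rightarrow>\<^sub>E pos_cone G L" "g \<in> J \<rightarrow>\<^sub>E pos_cone G L"
      using closed unfolding e by (auto simp: kite_def)
    ultimately show ?thesis
      unfolding e by (auto intro: PiE_ext)
  next
    fix x y assume e: "?e s = Inr x" "?e t = Inr y"
    have "x i = y i" if "i \<in> I" for i
      using same [of "{Inr i}"] that e by auto
    moreover have "x \<in> I \<rightarrow>\<^sub>E neg_cone G L" "y \<in> I \<rightarrow>\<^sub>E neg_cone G L"
      using closed unfolding e by (auto simp: kite_def)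
    ultimately show ?thesis
      unfolding e by (auto intro: PiE_ext)
  \<comment> \<open>The empty set of coordinates already rules out values in different
    summands.\<close>
  qed (use same [of "{}"] in auto)
qed

theorem theorem6p5:
  shows "(variety_generated_by (kites :: (('j \<Rightarrow> 'g) + ('i \<Rightarrow> 'g)) fl_alg set) :: 'a fl_alg set)
       = variety_generated_by (finite_dimensional_kites :: (('j \<Rightarrow> 'g) + ('i \<Rightarrow> 'g)) fl_alg set)"
proof -
  \<comment> \<open>Both intersections range over the same sets \<open>E\<close> of
    identities.\<close>
  have "(kites :: (('j \<Rightarrow> 'g) + ('i \<Rightarrow> 'g)) fl_alg set) \<subseteq> variety_of E \<longleftrightarrow>
      (finite_dimensional_kites :: (('j \<Rightarrow> 'g) + ('i \<Rightarrow> 'g)) fl_alg set) \<subseteq> variety_of E" for E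
  proof
    assume "(kites :: (('j \<Rightarrow> 'g) + ('i \<Rightarrow> 'g)) fl_alg set) \<subseteq> variety_of E"
    then show "(finite_dimensional_kites :: (('j \<Rightarrow> 'g) + ('i \<Rightarrow> 'g)) fl_alg set) \<subseteq> variety_of E"
      unfolding kites_def finite_dimensional_kites_def n_dimensional_kites_def by blast
  next
    assume fin: "(finite_dimensional_kites :: (('j \<Rightarrow> 'g) + ('i \<Rightarrow> 'g)) fl_alg set) \<subseteq> variety_of E"
    \<comment> \<open>Passing to finite parts changes neither the group nor the index types, so
      these kites belong to the very class that \<open>fin\<close> speaks of.\<close>
    have "satisfies (kite G L A B l r) e"
      if "e \<in> E" "finite A" "kite_data G L A B l r"
      for e and G :: "'g monoid" and L and A :: "'i set" and B :: "'j set" and l r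
    proof -
      have "kite G L A B l r \<in> finite_dimensional_kites"
        using that unfolding finite_dimensional_kites_def n_dimensional_kites_def by blast
      with fin that(1) show ?thesis by (auto simp: variety_of_def)
    qed
    then have "satisfies (kite G L I J l r) e" if "e \<in> E" "kite_data G L I J l r"
      for e and G :: "'g monoid" and L and I :: "'i set" and J :: "'j set" and l r
      using satisfies_if_finite_subkites [OF that(2), of "fst e" "snd e"] that(1) by simp
    then show "(kites :: (('j \<Rightarrow> 'g) + ('i \<Rightarrow> 'g)) fl_alg set) \<subseteq> variety_of E"
      by (auto simp: kites_def variety_of_def kite_fl_algebra)
  qed
  then show ?thesis
    by (simp add: variety_generated_by_def)
qed

end
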